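(* Let $M^m$ be a connected $m$-dimensional CW complex, let $\tau$ be a free cellular involution on $M^m$, and let $q:M^m\to M^m/\tau$ be the quotient map. If $\mathrm{secat}(q)=m+1$, then the index of $\tau$ on $M^m$ is $m$.
   Context: A free involution is a continuous involution without fixed points. The index of $\tau$ on $M^m$ is $\min\{n\in\{0,1,2,\ldots\}: \text{there is a continuous } \mathbb{Z}_2\text{-equivariant map } M^m\to S^n\}$, where $\mathbb{Z}_2$ acts on $M^m$ by $\tau$ and on $S^n$ by the antipodal map. The sectional category $\mathrm{secat}(q)$ of the 2-sheeted covering $q$ is the minimal cardinality of an open cover of $M^m/\tau$ such that over each member $U$ there is a continuous local section $s:U\to M^m$ (i.e. $q\circ s$ is the inclusion of $U$); $\mathrm{secat}(q)=\infty$ if no finite such cover exists. *)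

theory Defs
  imports "HOL-Analysis.Analysis" "HOL-Library.Extended_Nat"
begin

definition closed_disc :: "nat \<Rightarrow> (nat \<Rightarrow> real) set" where
  "closed_disc n = {x \<in> topspace (Euclidean_space n). (\<Sum>i<n. x i ^ 2) \<le> 1}"

definition open_disc :: "nat \<Rightarrow> (nat \<Rightarrow> real) set" where
  "open_disc n = {x \<in> topspace (Euclidean_space n). (\<Sum>i<n. x i ^ 2) < 1}"

text \<open>\<open>\<Phi>\<close> is a characteristic map for the open \<open>n\<close>-cell \<open>e\<close>, in a space whose
  open \<open>k\<close>-cells are the members of \<open>E k\<close>.  The last conjunct includes closure-finiteness.
  The boundary \<open>closed_disc n - open_disc n\<close> is empty for \<open>n = 0\<close>.\<close>

definition characteristic_map ::
  "'a topology \<Rightarrow> (nat \<Rightarrow> 'a set set) \<Rightarrow> nat \<Rightarrow> 'a set \<Rightarrow> ((nat \<Rightarrow> real) \<Rightarrow> 'a) \<Rightarrow> bool" where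
  "characteristic_map X E n e \<Phi> \<longleftrightarrow>
     continuous_map (subtopology (Euclidean_space n) (closed_disc n)) X \<Phi> \<and>
     homeomorphic_map (subtopology (Euclidean_space n) (open_disc n)) (subtopology X e) \<Phi> \<and>
     (\<exists>F. finite F \<and> F \<subseteq> (\<Union>k<n. E k) \<and> \<Phi> ` (closed_disc n - open_disc n) \<subseteq> \<Union>F)"

text \<open>A CW complex in the sense of Whitehead: a Hausdorff space partitioned into open cells, with
  the closure-finiteness condition and the weak topology.  Characteristic maps are required to
  exist but are not part of the data.\<close>

definition cw_complex :: "'a topology \<Rightarrow> (nat \<Rightarrow> 'a set set) \<Rightarrow> bool" where
  "cw_complex X E \<longleftrightarrow>
     Hausdorff_space X \<and>
     (\<Union>n. \<Union>(E n)) = topspace X \<and>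
     (\<forall>k n. \<forall>d\<in>E k. \<forall>e\<in>E n. d \<inter> e \<noteq> {} \<longrightarrow> k = n \<and> d = e) \<and>
     (\<forall>n. \<forall>e\<in>E n. e \<subseteq> topspace X \<and> (\<exists>\<Phi>. characteristic_map X E n e \<Phi>)) \<and>
     (\<forall>A\<subseteq>topspace X.
        (\<forall>n. \<forall>e\<in>E n. closedin X (A \<inter> X closure_of e)) \<longrightarrow> closedin X A)"

definition cw_dimension :: "(nat \<Rightarrow> 'a set set) \<Rightarrow> nat \<Rightarrow> bool" where
  "cw_dimension E m \<longleftrightarrow> E m \<noteq> {} \<and> (\<forall>k>m. E k = {})"

definition skeleton :: "(nat \<Rightarrow> 'a set set) \<Rightarrow> nat \<Rightarrow> 'a set" where
  "skeleton E n = (\<Union>k\<le>n. \<Union>(E k))"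

definition cellular_map ::
  "(nat \<Rightarrow> 'a set set) \<Rightarrow> (nat \<Rightarrow> 'b set set) \<Rightarrow> ('a \<Rightarrow> 'b) \<Rightarrow> bool" where
  "cellular_map E E' f \<longleftrightarrow> (\<forall>n. f ` skeleton E n \<subseteq> skeleton E' n)"

definition free_involution :: "'a topology \<Rightarrow> ('a \<Rightarrow> 'a) \<Rightarrow> bool" where
  "free_involution X \<tau> \<longleftrightarrow>
     continuous_map X X \<tau> \<and> (\<forall>x\<in>topspace X. \<tau> (\<tau> x) = x \<and> \<tau> x \<noteq> x)"

text \<open>\<open>invol_orbit \<tau>\<close> is the quotient map onto the orbit space, whose points are the
  orbits \<open>{x, \<tau> x}\<close>.\<close>

definition invol_orbit :: "('a \<Rightarrow> 'a) \<Rightarrow> 'a \<Rightarrow> 'a set" where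
  "invol_orbit \<tau> x = {x, \<tau> x}"

definition orbit_space :: "'a topology \<Rightarrow> ('a \<Rightarrow> 'a) \<Rightarrow> 'a set topology" where
  "orbit_space X \<tau> = topology (\<lambda>U. U \<subseteq> invol_orbit \<tau> ` topspace X \<and>
                                    openin X {x \<in> topspace X. invol_orbit \<tau> x \<in> U})"

lemma openin_orbit_space:
  "openin (orbit_space X \<tau>) U \<longleftrightarrow>
     U \<subseteq> invol_orbit \<tau> ` topspace X \<and> openin X {x \<in> topspace X. invol_orbit \<tau> x \<in> U}"
proof -
  let ?q = "invol_orbit \<tau>"
  have "istopology (\<lambda>U. U \<subseteq> ?q ` topspace X \<and> openin X {x \<in> topspace X. ?q x \<in> U})"
    unfolding istopology_def
  proof (intro conjI allI impI)
    fix S T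
    assume S: "S \<subseteq> ?q ` topspace X \<and> openin X {x \<in> topspace X. ?q x \<in> S}"
      and T: "T \<subseteq> ?q ` topspace X \<and> openin X {x \<in> topspace X. ?q x \<in> T}"
    show "S \<inter> T \<subseteq> ?q ` topspace X"
      using S by blast
    have "{x \<in> topspace X. ?q x \<in> S \<inter> T}
            = {x \<in> topspace X. ?q x \<in> S} \<inter> {x \<in> topspace X. ?q x \<in> T}"
      by blast
    then show "openin X {x \<in> topspace X. ?q x \<in> S \<inter> T}"
      using S T by (simp add: openin_Int)
  next
    fix K
    assume K: "\<forall>S\<in>K. S \<subseteq> ?q ` topspace X \<and> openin X {x \<in> topspace X. ?q x \<in> S}"
    show "\<Union>K \<subseteq> ?q ` topspace X"
      using K by blast
    have "{x \<in> topspace X. ?q x \<in> \<Union>K} = (\<Union>S\<in>K. {x \<in> topspace X. ?q x \<in> S})"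
      by blast
    then show "openin X {x \<in> topspace X. ?q x \<in> \<Union>K}"
      using K by auto
  qed
  then show ?thesis
    by (simp add: orbit_space_def topology_inverse')
qed

lemma topspace_orbit_space: "topspace (orbit_space X \<tau>) = invol_orbit \<tau> ` topspace X"
proof
  show "topspace (orbit_space X \<tau>) \<subseteq> invol_orbit \<tau> ` topspace X"
    using openin_topspace openin_orbit_space by blast
  have "{x \<in> topspace X. invol_orbit \<tau> x \<in> invol_orbit \<tau> ` topspace X} = topspace X"
    by blast
  then have "openin (orbit_space X \<tau>) (invol_orbit \<tau> ` topspace X)"
    by (simp add: openin_orbit_space)
  then show "invol_orbit \<tau> ` topspace X \<subseteq> topspace (orbit_space X \<tau>)"
    by (rule openin_subset)
qed

lemma quotient_map_orbit_space: "quotient_map X (orbit_space X \<tau>) (invol_orbit \<tau>)"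
  by (auto simp: quotient_map_def topspace_orbit_space openin_orbit_space)

text \<open>The index and the sectional category take the value \<open>\<infinity>\<close> (the infimum of the empty
  set in \<^typ>\<open>enat\<close>) if there is no admissible number; otherwise the infimum is attained.  The
  sectional category is not reduced by one: it counts the members of the cover.\<close>

definition involution_index :: "'a topology \<Rightarrow> ('a \<Rightarrow> 'a) \<Rightarrow> enat" where
  "involution_index X \<tau> =
     Inf {enat n | n. \<exists>f. continuous_map X (nsphere n) f \<and>
                          (\<forall>x\<in>topspace X. f (\<tau> x) = (\<lambda>i. - f x i))}"

definition secat :: "'a topology \<Rightarrow> 'b topology \<Rightarrow> ('a \<Rightarrow> 'b) \<Rightarrow> enat" where
  "secat X Y q =
     Inf {enat (card \<U>) | \<U>. finite \<U> \<and> (\<forall>U\<in>\<U>. openin Y U) \<and> \<Union>\<U> = topspace Y \<and>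
            (\<forall>U\<in>\<U>. \<exists>s. continuous_map (subtopology Y U) X s \<and> (\<forall>y\<in>U. q (s y) = y))}"

end

theory Submission
  imports Defs
begin

text \<open>For a free involution on a normal Hausdorff space, equivariant maps into \<open>S\<^sup>n\<close> and open covers
  of the orbit space by \<open>n + 1\<close> sets with local sections give rise to each other, and so the index is one
  less than the sectional category (\<open>involution_index_eq_secat_minus_1\<close>).

  An equivariant map \<open>f\<close> to \<open>S\<^sup>n\<close> yields the cover by the images of
  the sets \<open>f\<^sub>i > 0\<close>.  These sets contain at most one point of every orbit, which
  defines the section (\<open>secat_le_if_equivariant_map\<close>).  Conversely, a section over
  \<open>U\<close> singles out one point in each orbit of \<open>U\<close>.  If \<open>g\<close> is
  a function on the orbit space that vanishes outside \<open>U\<close>, then attaching to it the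
  sign \<open>+\<close> at the selected points and \<open>-\<close> at the others gives a continuous
  odd function on \<open>X\<close> (\<open>odd_function_from_section\<close>).  With one such
  function for each of \<open>n + 1\<close> members of a cover, never all zero at once,
  normalisation gives an equivariant map to \<open>S\<^sup>n\<close>
  (\<open>equivariant_map_from_sections\<close>).

  The functions \<open>g\<close> exist when the orbit space is normal.  Normality passes from \<open>X\<close> to the orbit
  space, since the quotient map is closed, and a CW complex is normal
  (\<open>cw_complex_imp_normal_space\<close>): a Urysohn function for two disjoint closed sets is built
  dimension by dimension, extending it from the boundary of each cell to its interior by Tietze's
  theorem on the disc, and the weak topology makes the result continuous.\<close>

section \<open>Closed discs and normality\<close>

text \<open>A closed subset of the cube \<open>[-1,1]\<^sup>\<nat>\<close>, which is compact by Tychonoff.\<close>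

lemma compactin_closed_disc: "compactin (Euclidean_space n) (closed_disc n)"
proof -
  let ?P = "powertop_real (UNIV :: nat set)"
  have "closedin ?P {x \<in> topspace ?P. (\<Sum>i<n. x i ^ 2) \<in> {..1}}"
    by (rule closedin_continuous_map_preimage)
      (auto intro!: continuous_map_sum continuous_map_real_pow continuous_map_product_projection)
  then have "closedin ?P ({x \<in> topspace ?P. (\<Sum>i<n. x i ^ 2) \<in> {..1}} \<inter> topspace (Euclidean_space n))"
    using closedin_Euclidean_space by blast
  also have "{x \<in> topspace ?P. (\<Sum>i<n. x i ^ 2) \<in> {..1}} \<inter> topspace (Euclidean_space n) = closed_disc n"
    by (auto simp: closed_disc_def)
  finally have closed: "closedin ?P (closed_disc n)" .
  have "x i \<in> {-1..1}" if x: "x \<in> closed_disc n" for x i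
  proof (cases "i < n")
    case True
    have "x i ^ 2 \<le> (\<Sum>i<n. x i ^ 2)"
      using True by (intro member_le_sum) auto
    also have "\<dots> \<le> 1"
      using x by (simp add: closed_disc_def)
    finally have "\<bar>x i\<bar> \<le> 1"
      by (simp add: abs_square_le_1)
    then show ?thesis by auto
  next
    case False
    then show ?thesis
      using x by (simp add: closed_disc_def topspace_Euclidean_space)
  qed
  then have "closed_disc n \<subseteq> PiE UNIV (\<lambda>i. {-1..1})"
    by auto
  moreover have "compactin ?P (PiE UNIV (\<lambda>i. {-1..1}))"
    by (simp add: compactin_PiE)
  ultimately have "compactin ?P (closed_disc n)"
    using closed closed_compactin by blast
  then show ?thesis
    by (auto simp: Euclidean_space_def compactin_subtopology closed_disc_def)
qed

lemma closedin_disc_boundary: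
  "closedin (subtopology (Euclidean_space n) (closed_disc n)) (closed_disc n - open_disc n)"
proof -
  let ?D = "subtopology (Euclidean_space n) (closed_disc n)"
  have "closedin ?D {x \<in> topspace ?D. (\<Sum>i<n. x i ^ 2) \<in> {1..}}"
    by (rule closedin_continuous_map_preimage)
      (auto simp: Euclidean_space_def
        intro!: continuous_map_sum continuous_map_real_pow continuous_map_product_projection
          continuous_map_from_subtopology)
  also have "{x \<in> topspace ?D. (\<Sum>i<n. x i ^ 2) \<in> {1..}} = closed_disc n - open_disc n"
    by (auto simp: closed_disc_def open_disc_def)
  finally show ?thesis .
qed

lemma open_disc_subset_closed_disc: "open_disc n \<subseteq> closed_disc n"
  by (auto simp: closed_disc_def open_disc_def)

lemma topspace_Int_closed_disc [simp]:
  "topspace (Euclidean_space n) \<inter> closed_disc n = closed_disc n"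
  by (auto simp: closed_disc_def)

lemma normal_space_closed_disc: "normal_space (subtopology (Euclidean_space n) (closed_disc n))"
  using compactin_closed_disc Hausdorff_Euclidean_space
  by (meson Hausdorff_space_subtopology compact_Hausdorff_or_regular_imp_normal_space
      compact_space_subtopology)

text \<open>Tietze's theorem with values prescribed on two further closed sets: the three prescriptions
  agree where they overlap, so they paste to a continuous function on a closed set.\<close>

lemma Tietze_Urysohn_extension:
  assumes "normal_space D" and S: "closedin D S" and P: "closedin D P" and Q: "closedin D Q"
    and "P \<inter> Q = {}"
    and f: "continuous_map (subtopology D S) euclideanreal f" "f ` S \<subseteq> {0..1}"
    and fP: "\<And>x. x \<in> S \<inter> P \<Longrightarrow> f x = 0" and fQ: "\<And>x. x \<in> S \<inter> Q \<Longrightarrow> f x = 1"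
  obtains g where "continuous_map D euclideanreal g" "g ` topspace D \<subseteq> {0..1}"
    "\<And>x. x \<in> S \<Longrightarrow> g x = f x" "\<And>x. x \<in> P \<Longrightarrow> g x = 0" "\<And>x. x \<in> Q \<Longrightarrow> g x = 1"
proof -
  let ?C = "S \<union> P \<union> Q"
  define h where "h = (\<lambda>x. if x \<in> P then 0 else if x \<in> Q then 1 else f x)"
  have hS: "h x = f x" if "x \<in> S" for x
    using that fP fQ by (auto simp: h_def)
  have hQ: "h x = 1" if "x \<in> Q" for x
    using that \<open>P \<inter> Q = {}\<close> by (auto simp: h_def)
  have hcont: "continuous_map (subtopology D T) euclideanreal h" if "T \<in> {P, Q, S}" for T
  proof -
    have "continuous_map (subtopology D P) euclideanreal h"
      by (rule continuous_map_eq [where f = "\<lambda>x. 0"]) (auto simp: h_def)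
    moreover have "continuous_map (subtopology D Q) euclideanreal h"
      by (rule continuous_map_eq [where f = "\<lambda>x. 1"]) (auto simp: hQ)
    moreover have "continuous_map (subtopology D S) euclideanreal h"
      by (rule continuous_map_eq [OF f(1)]) (auto simp: hS)
    ultimately show ?thesis
      using that by blast
  qed
  have cont: "continuous_map (subtopology D ?C) euclideanreal h"
  proof (rule pasting_lemma_closed [where I = "{P, Q, S}" and T = "\<lambda>T. T" and f = "\<lambda>_. h"])
    fix T assume T: "T \<in> {P, Q, S}"
    then have TC: "T \<subseteq> ?C"
      by blast
    then show "continuous_map (subtopology (subtopology D ?C) T) euclideanreal h"
      using hcont [OF T] by (simp add: subtopology_subtopology inf.absorb2)
    have "closedin D T"
      using T P Q S by blast
    then show "closedin (subtopology D ?C) T"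
      using TC by (rule closedin_subset_topspace)
  next
    fix x assume "x \<in> topspace (subtopology D ?C)"
    then have "x \<in> ?C"
      by simp
    then show "\<exists>T. T \<in> {P, Q, S} \<and> x \<in> T \<and> h x = h x"
      by blast
  qed simp_all
  have C: "closedin D ?C"
    using S P Q by auto
  have "h ` ?C \<subseteq> {0..1}"
    using f(2) by (auto simp: h_def)
  then obtain g where "continuous_map D euclideanreal g" "g ` topspace D \<subseteq> {0..1}"
      "\<And>x. x \<in> ?C \<Longrightarrow> g x = h x"
    using Tietze_extension_realinterval [OF \<open>normal_space D\<close> C _ _ cont, of "{0..1}"]
    by (auto simp: is_interval_cc)
  with that hS hQ show thesis
    by (auto simp: h_def)
qed

section \<open>The cells of a CW complex\<close>

lemma cw_Hausdorff: "cw_complex X E \<Longrightarrow> Hausdorff_space X"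
  unfolding cw_complex_def by (elim conjE)

lemma cw_cells_cover: "cw_complex X E \<Longrightarrow> (\<Union>n. \<Union>(E n)) = topspace X"
  unfolding cw_complex_def by (elim conjE)

lemma cw_cells_unique:
  assumes "cw_complex X E" "d \<in> E k" "e \<in> E n" "x \<in> d" "x \<in> e"
  shows "k = n \<and> d = e"
proof -
  have "\<forall>k n. \<forall>d\<in>E k. \<forall>e\<in>E n. d \<inter> e \<noteq> {} \<longrightarrow> k = n \<and> d = e"
    using assms(1) unfolding cw_complex_def by (elim conjE)
  moreover have "d \<inter> e \<noteq> {}"
    using assms(4,5) by blast
  ultimately show ?thesis
    using assms(2,3) by meson
qed

lemma cw_cell:
  assumes "cw_complex X E" "e \<in> E n"
  shows cw_cell_subset: "e \<subseteq> topspace X"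
    and cw_characteristic_map: "\<exists>\<Phi>. characteristic_map X E n e \<Phi>"
proof -
  have "\<forall>n. \<forall>e\<in>E n. e \<subseteq> topspace X \<and> (\<exists>\<Phi>. characteristic_map X E n e \<Phi>)"
    using assms(1) unfolding cw_complex_def by (elim conjE)
  then show "e \<subseteq> topspace X" "\<exists>\<Phi>. characteristic_map X E n e \<Phi>"
    using assms(2) by simp_all
qed

lemma cw_weak_topology:
  assumes "cw_complex X E" "A \<subseteq> topspace X"
    and "\<And>n e. e \<in> E n \<Longrightarrow> closedin X (A \<inter> X closure_of e)"
  shows "closedin X A"
proof -
  have "\<forall>A\<subseteq>topspace X. (\<forall>n. \<forall>e\<in>E n. closedin X (A \<inter> X closure_of e)) \<longrightarrow> closedin X A"
    using assms(1) unfolding cw_complex_def by (elim conjE)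
  then show ?thesis
    using assms(2,3) by simp
qed

text \<open>The closed cell \<open>\<Phi> ` closed_disc n\<close> is compact, hence closed in the Hausdorff space \<open>X\<close>, and it
  contains \<open>e\<close>.\<close>

lemma cw_cell_closure:
  assumes "cw_complex X E" and "e \<in> E n" and \<Phi>: "characteristic_map X E n e \<Phi>"
  shows "\<Phi> ` open_disc n = e" and "inj_on \<Phi> (open_disc n)"
    and "X closure_of e \<subseteq> \<Phi> ` closed_disc n"
proof -
  have e: "e \<subseteq> topspace X" and X: "Hausdorff_space X"
    using assms(1,2) cw_cell_subset cw_Hausdorff by blast+
  have "open_disc n \<subseteq> topspace (Euclidean_space n)"
    by (auto simp: open_disc_def)
  moreover have "homeomorphic_map (subtopology (Euclidean_space n) (open_disc n)) (subtopology X e) \<Phi>"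
    using \<Phi> by (simp add: characteristic_map_def)
  ultimately show im: "\<Phi> ` open_disc n = e" and "inj_on \<Phi> (open_disc n)"
    using e by (simp_all add: homeomorphic_eq_everything_map inf.absorb2)
  have "compactin (subtopology (Euclidean_space n) (closed_disc n)) (closed_disc n)"
    using compactin_closed_disc by (simp add: compactin_subtopology)
  then have "compactin X (\<Phi> ` closed_disc n)"
    using \<Phi> image_compactin characteristic_map_def by blast
  then have closed: "closedin X (\<Phi> ` closed_disc n)"
    using X compactin_imp_closedin by blast
  have "e \<subseteq> \<Phi> ` closed_disc n"
    using im open_disc_subset_closed_disc by blast
  then show "X closure_of e \<subseteq> \<Phi> ` closed_disc n"
    using closed by (rule closure_of_minimal)
qed

lemma closure_cell_subset:
  assumes cw: "cw_complex X E" and e: "e \<in> E n"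
  shows "X closure_of e \<subseteq> (\<Union>k\<le>n. \<Union>(E k))"
proof
  fix x assume x: "x \<in> X closure_of e"
  obtain \<Phi> where \<Phi>: "characteristic_map X E n e \<Phi>"
    using cw_characteristic_map [OF cw e] by blast
  obtain F where F: "F \<subseteq> (\<Union>k<n. E k)" "\<Phi> ` (closed_disc n - open_disc n) \<subseteq> \<Union>F"
    using \<Phi> unfolding characteristic_map_def by blast
  have "x \<in> \<Phi> ` closed_disc n"
    using cw_cell_closure(3)[OF cw e \<Phi>] x by (rule subsetD)
  then obtain z where z: "z \<in> closed_disc n" "x = \<Phi> z"
    by blast
  show "x \<in> (\<Union>k\<le>n. \<Union>(E k))"
  proof (cases "z \<in> open_disc n")
    case True
    then have "x \<in> e"
      using cw_cell_closure(1)[OF cw e \<Phi>] z(2) by (metis imageI)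
    then show ?thesis
      using e by blast
  next
    case False
    then have "x \<in> \<Union>F"
      using z F(2) by blast
    then obtain d k where "x \<in> d" "d \<in> E k" "k < n"
      using F(1) by blast
    then show ?thesis
      by (auto intro!: bexI [of _ k])
  qed
qed

section \<open>Extending Urysohn functions over cells\<close>

text \<open>A Urysohn function for \<open>A\<close> and \<open>B\<close> whose continuity is known only on the closed cells of
  dimension below \<open>n\<close>.  It is a function on all of \<open>X\<close>, arbitrary on the remaining cells but for its
  bounds and its values on \<open>A\<close> and \<open>B\<close>; thus the induction on \<open>n\<close> starts from the indicator
  function of \<open>B\<close>.\<close>

definition partial_separation ::
  "'a topology \<Rightarrow> (nat \<Rightarrow> 'a set set) \<Rightarrow> 'a set \<Rightarrow> 'a set \<Rightarrow> nat \<Rightarrow> ('a \<Rightarrow> real) \<Rightarrow> bool" where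
  "partial_separation X E A B n f \<longleftrightarrow>
     f ` topspace X \<subseteq> {0..1} \<and> f ` A \<subseteq> {0} \<and> f ` B \<subseteq> {1} \<and>
     (\<forall>k<n. \<forall>e\<in>E k. continuous_map (subtopology X (X closure_of e)) euclideanreal f)"

text \<open>The attaching map sends the boundary sphere into finitely many lower closed cells.  On their
  union \<open>f\<close> is continuous by pasting, so \<open>f \<circ> \<Phi>\<close> is continuous on the sphere and extends over
  the compact Hausdorff, hence normal, disc.\<close>

lemma extend_over_cell:
  assumes cw: "cw_complex X E" and A: "closedin X A" and B: "closedin X B" and "A \<inter> B = {}"
    and f: "partial_separation X E A B n f" and e: "e \<in> E n"
    and \<Phi>: "characteristic_map X E n e \<Phi>"
  obtains g where
    "continuous_map (subtopology (Euclidean_space n) (closed_disc n)) euclideanreal g"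
    "g ` closed_disc n \<subseteq> {0..1}"
    "\<And>z. z \<in> closed_disc n - open_disc n \<Longrightarrow> g z = f (\<Phi> z)"
    "\<And>z. \<lbrakk>z \<in> closed_disc n; \<Phi> z \<in> A\<rbrakk> \<Longrightarrow> g z = 0"
    "\<And>z. \<lbrakk>z \<in> closed_disc n; \<Phi> z \<in> B\<rbrakk> \<Longrightarrow> g z = 1"
proof -
  let ?D = "subtopology (Euclidean_space n) (closed_disc n)"
  let ?S = "closed_disc n - open_disc n"
  have cont: "continuous_map ?D X \<Phi>"
    using \<Phi> by (simp add: characteristic_map_def)
  have f01: "f ` topspace X \<subseteq> {0..1}" and fA: "f ` A \<subseteq> {0}" and fB: "f ` B \<subseteq> {1}"
    and fcont: "\<And>k d. \<lbrakk>k < n; d \<in> E k\<rbrakk> \<Longrightarrow>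
      continuous_map (subtopology X (X closure_of d)) euclideanreal f"
    using f by (auto simp: partial_separation_def)
  obtain F where F: "finite F" "F \<subseteq> (\<Union>k<n. E k)" "\<Phi> ` ?S \<subseteq> \<Union>F"
    using \<Phi> unfolding characteristic_map_def by blast
  let ?U = "\<Union>d\<in>F. X closure_of d"
  have sub: "d \<subseteq> X closure_of d" if "d \<in> F" for d
    using F(2) that cw_cell_subset [OF cw] by (intro closure_of_subset) blast
  have "continuous_map (subtopology X ?U) euclideanreal f"
  proof (rule pasting_lemma_closed [where I = F and T = "\<lambda>d. X closure_of d" and f = "\<lambda>_. f"])
    show "finite F" by fact
    show "closedin (subtopology X ?U) (X closure_of d)" if "d \<in> F" for d
      using that by (intro closedin_subset_topspace) auto
    show "continuous_map (subtopology (subtopology X ?U) (X closure_of d)) euclideanreal f"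
      if "d \<in> F" for d
    proof -
      have "?U \<inter> X closure_of d = X closure_of d"
        using that by auto
      then show ?thesis
        using that F fcont by (auto simp: subtopology_subtopology)
    qed
  qed auto
  moreover have "\<Phi> ` ?S \<subseteq> ?U"
    using F sub by blast
  then have "continuous_map (subtopology ?D ?S) (subtopology X ?U) \<Phi>"
    using cont by (auto simp: continuous_map_in_subtopology continuous_map_from_subtopology)
  ultimately have fS: "continuous_map (subtopology ?D ?S) euclideanreal (f \<circ> \<Phi>)"
    using continuous_map_compose by blast
  have \<Phi>X: "\<Phi> ` closed_disc n \<subseteq> topspace X"
    using continuous_map_image_subset_topspace [OF cont] by simp
  let ?P = "{z \<in> topspace ?D. \<Phi> z \<in> A}" and ?Q = "{z \<in> topspace ?D. \<Phi> z \<in> B}"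
  have PQ: "closedin ?D ?P" "closedin ?D ?Q"
    using closedin_continuous_map_preimage [OF cont] A B by blast+
  show thesis
  proof (rule Tietze_Urysohn_extension
      [OF normal_space_closed_disc closedin_disc_boundary PQ _ fS])
    show "?P \<inter> ?Q = {}"
      using \<open>A \<inter> B = {}\<close> by blast
    show "(f \<circ> \<Phi>) ` ?S \<subseteq> {0..1}"
    proof -
      have "\<Phi> ` ?S \<subseteq> topspace X"
        using \<Phi>X by blast
      then show ?thesis
        using f01 by (metis image_comp image_mono order_trans)
    qed
    show "(f \<circ> \<Phi>) z = 0" if "z \<in> ?S \<inter> ?P" for z
      using that fA by auto
    show "(f \<circ> \<Phi>) z = 1" if "z \<in> ?S \<inter> ?Q" for z
      using that fB by auto
  qed (use that in auto)
qed

text \<open>On each \<open>n\<close>-cell \<open>f\<close> is replaced by the extension from its boundary.  Continuity on a closed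
  \<open>n\<close>-cell descends from the disc, because a continuous map from a compact space onto a Hausdorff
  space is a quotient map; on the lower closed cells nothing changes.\<close>

lemma partial_separation_step:
  assumes cw: "cw_complex X E" and A: "closedin X A" and B: "closedin X B" and "A \<inter> B = {}"
    and f: "partial_separation X E A B n f"
  obtains f' where "partial_separation X E A B (Suc n) f'"
    "\<And>x. x \<notin> \<Union>(E n) \<Longrightarrow> f' x = f x"
proof -
  let ?D = "subtopology (Euclidean_space n) (closed_disc n)"
  have X: "Hausdorff_space X"
    using cw by (rule cw_Hausdorff)
  have f01: "f ` topspace X \<subseteq> {0..1}" and fA: "f ` A \<subseteq> {0}" and fB: "f ` B \<subseteq> {1}"
    and fcont: "\<And>k d. \<lbrakk>k < n; d \<in> E k\<rbrakk> \<Longrightarrow>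
      continuous_map (subtopology X (X closure_of d)) euclideanreal f"
    using f by (auto simp: partial_separation_def)
  have "\<exists>\<Phi>. characteristic_map X E n e \<Phi>" if "e \<in> E n" for e
    using cw_characteristic_map [OF cw that] .
  then obtain \<Phi> where \<Phi>: "\<And>e. e \<in> E n \<Longrightarrow> characteristic_map X E n e (\<Phi> e)"
    by metis
  note cell = cw_cell_closure [OF cw _ \<Phi>]
  define extends where "extends = (\<lambda>e g. continuous_map ?D euclideanreal g \<and>
     g ` closed_disc n \<subseteq> {0..1} \<and>
     (\<forall>z \<in> closed_disc n - open_disc n. g z = f (\<Phi> e z)) \<and>
     (\<forall>z \<in> closed_disc n. \<Phi> e z \<in> A \<longrightarrow> g z = (0::real)) \<and>
     (\<forall>z \<in> closed_disc n. \<Phi> e z \<in> B \<longrightarrow> g z = 1))"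
  have "\<exists>g. extends e g" if "e \<in> E n" for e
    unfolding extends_def
    by (rule extend_over_cell [OF assms that \<Phi>[OF that]]) blast
  then obtain g where g: "\<And>e. e \<in> E n \<Longrightarrow> extends e (g e)"
    by metis
  have gcont: "\<And>e. e \<in> E n \<Longrightarrow> continuous_map ?D euclideanreal (g e)"
    and g01: "\<And>e. e \<in> E n \<Longrightarrow> g e ` closed_disc n \<subseteq> {0..1}"
    and gS: "\<And>e z. \<lbrakk>e \<in> E n; z \<in> closed_disc n - open_disc n\<rbrakk> \<Longrightarrow> g e z = f (\<Phi> e z)"
    and gA: "\<And>e z. \<lbrakk>e \<in> E n; z \<in> closed_disc n; \<Phi> e z \<in> A\<rbrakk> \<Longrightarrow> g e z = 0"
    and gB: "\<And>e z. \<lbrakk>e \<in> E n; z \<in> closed_disc n; \<Phi> e z \<in> B\<rbrakk> \<Longrightarrow> g e z = 1"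
    using g by (simp_all add: extends_def)
  define f' where "f' = (\<lambda>x. if x \<in> \<Union>(E n)
     then let e = THE e. e \<in> E n \<and> x \<in> e in g e (inv_into (open_disc n) (\<Phi> e) x) else f x)"
  have f'_off: "f' x = f x" if "x \<notin> \<Union>(E n)" for x
    using that by (simp add: f'_def)
  have f'_open: "f' (\<Phi> e z) = g e z" if e: "e \<in> E n" and z: "z \<in> open_disc n" for e z
  proof -
    have "\<Phi> e z \<in> e"
      using imageI [OF z, of "\<Phi> e"] cell(1)[OF e e] by simp
    moreover have "(THE e'. e' \<in> E n \<and> \<Phi> e z \<in> e') = e"
    proof (rule the_equality)
      show "e \<in> E n \<and> \<Phi> e z \<in> e"
        using e \<open>\<Phi> e z \<in> e\<close> by (rule conjI)
      show "d = e" if "d \<in> E n \<and> \<Phi> e z \<in> d" for d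
        using cw_cells_unique [OF cw conjunct1 [OF that] e conjunct2 [OF that] \<open>\<Phi> e z \<in> e\<close>]
        by (rule conjunct2)
    qed
    moreover have "\<Phi> e z \<in> \<Union>(E n)"
      using e \<open>\<Phi> e z \<in> e\<close> by (rule UnionI)
    ultimately show ?thesis
      using inv_into_f_f [OF cell(2)[OF e e] z] by (simp only: f'_def Let_def if_True)
  qed
  have lower: "x \<notin> \<Union>(E n)" if "k \<noteq> n" "d \<in> E k" "x \<in> d" for x k d
    using that cw_cells_unique [OF cw, of d k _ n x] by blast
  \<comment> \<open>The characteristic map is injective only on the open disc; on the sphere both sides are values of the old \<open>f\<close>.\<close>
  have f'_closed: "f' (\<Phi> e z) = g e z" if e: "e \<in> E n" and z: "z \<in> closed_disc n" for e z
  proof (cases "z \<in> open_disc n")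
    case False
    obtain F where F: "F \<subseteq> (\<Union>k<n. E k)" "\<Phi> e ` (closed_disc n - open_disc n) \<subseteq> \<Union>F"
      using \<Phi>[OF e] unfolding characteristic_map_def by blast
    have "\<Phi> e z \<in> \<Union>F"
      using F(2) z False by blast
    then obtain k d where "k < n" "d \<in> E k" "\<Phi> e z \<in> d"
      using F(1) by blast
    then have "f' (\<Phi> e z) = f (\<Phi> e z)"
      using f'_off lower [of k d] by simp
    then show ?thesis
      using gS e z False by simp
  qed (simp add: f'_open e)
  have new: "\<exists>e z. e \<in> E n \<and> z \<in> closed_disc n \<and> x = \<Phi> e z"
    if x: "x \<in> \<Union>(E n)" for x
  proof -
    obtain e where e: "e \<in> E n" "x \<in> e"
      using x by blast
    then have "x \<in> \<Phi> e ` open_disc n"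
      using cell(1)[OF e(1) e(1)] by simp
    then show ?thesis
      using e(1) open_disc_subset_closed_disc by blast
  qed
  have cont_new: "continuous_map (subtopology X (X closure_of e)) euclideanreal f'"
    if e: "e \<in> E n" for e
  proof -
    have \<Phi>e: "continuous_map ?D X (\<Phi> e)"
      using \<Phi>[OF e] by (simp add: characteristic_map_def)
    let ?K = "\<Phi> e ` closed_disc n"
    have "?K \<subseteq> topspace X"
      using continuous_map_image_subset_topspace [OF \<Phi>e] by simp
    moreover have "compact_space ?D"
      using compactin_closed_disc by (rule compact_space_subtopology)
    ultimately have "quotient_map ?D (subtopology X ?K) (\<Phi> e)"
      using \<Phi>e X
      by (intro continuous_imp_quotient_map)
        (auto simp: continuous_map_in_subtopology Hausdorff_space_subtopology inf.absorb2)
    moreover have "continuous_map ?D euclideanreal (f' \<circ> \<Phi> e)"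
      by (rule continuous_map_eq [OF gcont[OF e]]) (simp add: f'_closed e)
    ultimately have "continuous_map (subtopology X ?K) euclideanreal f'"
      by (rule continuous_compose_quotient_map)
    then show ?thesis
      using cell(3)[OF e e] continuous_map_from_subtopology_mono by blast
  qed
  have cont_old: "continuous_map (subtopology X (X closure_of d)) euclideanreal f'"
    if "k < n" "d \<in> E k" for k d
  proof (rule continuous_map_eq [OF fcont[OF that]])
    fix x assume "x \<in> topspace (subtopology X (X closure_of d))"
    then have "x \<in> X closure_of d"
      by simp
    then have "x \<in> (\<Union>j\<le>k. \<Union>(E j))"
      by (rule subsetD [OF closure_cell_subset [OF cw that(2)]])
    then obtain j where "j \<le> k" "x \<in> \<Union>(E j)"
      by blast
    then have "x \<notin> \<Union>(E n)"
      using lower [of j] \<open>k < n\<close> by auto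
    then show "f x = f' x"
      using f'_off by simp
  qed
  have f_values: "(x \<in> topspace X \<longrightarrow> f' x \<in> {0..1}) \<and> (x \<in> A \<longrightarrow> f' x = 0) \<and> (x \<in> B \<longrightarrow> f' x = 1)" for x
  proof (cases "x \<in> \<Union>(E n)")
    case True
    then obtain e z where ez: "e \<in> E n" "z \<in> closed_disc n" and x: "x = \<Phi> e z"
      using new by blast
    have "f' x = g e z"
      unfolding x using ez by (rule f'_closed)
    moreover have "g e z \<in> {0..1}"
      using g01 ez by blast
    ultimately show ?thesis
      using gA [OF ez] gB [OF ez] unfolding x by simp
  next
    case False
    then show ?thesis
      using f'_off f01 fA fB by (simp add: image_subset_iff)
  qed
  have "partial_separation X E A B (Suc n) f'"
    unfolding partial_separation_def less_Suc_eq
    using f_values cont_old cont_new by blast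
  with f'_off that show thesis by blast
qed

section \<open>Normality of CW complexes\<close>

text \<open>Successive extensions change the Urysohn function on a given cell only once, so they have a
  pointwise limit.  It is continuous on each closed cell, hence continuous by the weak topology.\<close>

theorem cw_complex_imp_normal_space:
  assumes cw: "cw_complex X E"
  shows "normal_space X"
proof -
  have "\<exists>f. continuous_map X euclideanreal f \<and> f ` A \<subseteq> {0} \<and> f ` B \<subseteq> {1}"
    if A: "closedin X A" and B: "closedin X B" and "disjnt A B" for A B
  proof -
    have AB: "A \<inter> B = {}"
      using \<open>disjnt A B\<close> by (simp add: disjnt_def)
    have "partial_separation X E A B 0 (\<lambda>x. if x \<in> B then 1 else 0)"
      using AB by (auto simp: partial_separation_def)
    then obtain F where F: "\<And>n. partial_separation X E A B n (F n)"
      and Fstep: "\<And>n x. x \<notin> \<Union>(E n) \<Longrightarrow> F (Suc n) x = F n x"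
      using dependent_nat_choice
        [where P = "partial_separation X E A B"
          and Q = "\<lambda>n f f'. \<forall>x. x \<notin> \<Union>(E n) \<longrightarrow> f' x = f x"]
        partial_separation_step [OF cw A B AB]
      by metis
    \<comment> \<open>A cell of dimension \<open>k\<close> receives its final values at stage \<open>Suc k\<close>.\<close>
    define f where "f = (\<lambda>x. F (Suc (SOME k. x \<in> \<Union>(E k))) x)"
    have f_eq: "f x = F n x" if x: "x \<in> \<Union>(E k)" and "k < n" for x k n
    proof -
      have some: "(SOME j. x \<in> \<Union>(E j)) = k"
        using x cw_cells_unique [OF cw] by (intro some_equality) blast+
      have "F n x = F (Suc k) x"
        using Suc_leI [OF \<open>k < n\<close>]
      proof (induction n rule: dec_induct)
        case (step j)
        then have "x \<notin> \<Union>(E j)"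
          using x cw_cells_unique [OF cw, of _ j _ k x] by auto
        then show ?case
          using Fstep step.IH by simp
      qed simp
      then show ?thesis
        unfolding f_def some by (rule sym)
    qed
    have cell: "\<exists>k. x \<in> \<Union>(E k)" if "x \<in> topspace X" for x
      using that cw_cells_cover [OF cw] by blast
    have f_values: "f x \<in> {0..1}" "x \<in> A \<Longrightarrow> f x = 0" "x \<in> B \<Longrightarrow> f x = 1"
      if x: "x \<in> topspace X" for x
    proof -
      obtain k where "x \<in> \<Union>(E k)"
        using cell [OF x] by blast
      then have "f x = F (Suc k) x"
        using f_eq by blast
      then show "f x \<in> {0..1}" "x \<in> A \<Longrightarrow> f x = 0" "x \<in> B \<Longrightarrow> f x = 1"
        using F[of "Suc k"] x by (auto simp: partial_separation_def image_subset_iff)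
    qed
    have on_cells: "continuous_map (subtopology X (X closure_of e)) euclideanreal f"
      if e: "e \<in> E k" for e k
    proof (rule continuous_map_eq)
      show "continuous_map (subtopology X (X closure_of e)) euclideanreal (F (Suc k))"
        using F[of "Suc k"] e lessI [of k] unfolding partial_separation_def by blast
      fix x assume "x \<in> topspace (subtopology X (X closure_of e))"
      then have "x \<in> X closure_of e"
        by simp
      then have "x \<in> (\<Union>j\<le>k. \<Union>(E j))"
        by (rule subsetD [OF closure_cell_subset [OF cw e]])
      then obtain j where "j \<le> k" "x \<in> \<Union>(E j)"
        by blast
      then show "F (Suc k) x = f x"
        using f_eq [OF _ le_imp_less_Suc] by simp
    qed
    have "continuous_map X euclideanreal f"
      unfolding continuous_map_closedin
    proof (intro conjI allI impI)
      fix C :: "real set" assume C: "closedin euclidean C"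
      let ?Z = "{x \<in> topspace X. f x \<in> C}"
      have "closedin X (?Z \<inter> X closure_of e)" if "e \<in> E k" for e k
      proof -
        let ?K = "subtopology X (X closure_of e)"
        have "closedin ?K {x \<in> topspace ?K. f x \<in> C}"
          using on_cells [OF that] C by (rule closedin_continuous_map_preimage)
        also have "{x \<in> topspace ?K. f x \<in> C} = ?Z \<inter> X closure_of e"
          by auto
        finally show ?thesis
          by (meson closedin_closure_of closedin_trans_full)
      qed
      then show "closedin X ?Z"
        using cw_weak_topology [OF cw, of ?Z] by blast
    qed auto
    with f_values show ?thesis
      using closedin_subset [OF A] closedin_subset [OF B] by blast
  qed
  then show ?thesis
    by (simp add: normal_space_iff_Urysohn_gen_alt [of 0 1])
qed

section \<open>The orbit space of a free involution\<close>

lemma free_involution_in_topspace: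
  "\<lbrakk>free_involution X \<tau>; x \<in> topspace X\<rbrakk> \<Longrightarrow> \<tau> x \<in> topspace X"
  by (auto simp: free_involution_def continuous_map_def)

lemma invol_orbit_eq_iff:
  assumes "free_involution X \<tau>" "x \<in> topspace X"
  shows "invol_orbit \<tau> z = invol_orbit \<tau> x \<longleftrightarrow> z = x \<or> z = \<tau> x"
  using assms by (auto simp: invol_orbit_def free_involution_def doubleton_eq_iff)

lemma invol_orbit_preimage:
  assumes \<tau>: "free_involution X \<tau>" and T: "T \<subseteq> topspace X"
  shows "{x \<in> topspace X. invol_orbit \<tau> x \<in> invol_orbit \<tau> ` T} = T \<union> {x \<in> topspace X. \<tau> x \<in> T}"
proof -
  have "invol_orbit \<tau> x \<in> invol_orbit \<tau> ` T \<longleftrightarrow> x \<in> T \<or> \<tau> x \<in> T" if "x \<in> topspace X" for x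
  proof -
    have "invol_orbit \<tau> x \<in> invol_orbit \<tau> ` T \<longleftrightarrow> (\<exists>t\<in>T. invol_orbit \<tau> t = invol_orbit \<tau> x)"
      by (metis imageE imageI)
    also have "\<dots> \<longleftrightarrow> (\<exists>t\<in>T. t = x \<or> t = \<tau> x)"
      by (simp only: invol_orbit_eq_iff [OF \<tau> that])
    finally show ?thesis by blast
  qed
  then show ?thesis
    using T by blast
qed

text \<open>The saturation of a closed set \<open>C\<close> is the union of \<open>C\<close> and its preimage under \<open>\<tau>\<close>.\<close>

lemma closed_map_invol_orbit:
  assumes \<tau>: "free_involution X \<tau>"
  shows "closed_map X (orbit_space X \<tau>) (invol_orbit \<tau>)"
proof (unfold closed_map_def, intro allI impI)
  fix C assume C: "closedin X C"
  let ?q = "invol_orbit \<tau>"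
  have "closedin X {x \<in> topspace X. \<tau> x \<in> C}"
    using \<tau> C closedin_continuous_map_preimage by (fastforce simp: free_involution_def)
  with C have "closedin X (C \<union> {x \<in> topspace X. \<tau> x \<in> C})"
    by blast
  also have "C \<union> {x \<in> topspace X. \<tau> x \<in> C} = {x \<in> topspace X. ?q x \<in> ?q ` C}"
    using invol_orbit_preimage [OF \<tau> closedin_subset [OF C]] by (rule sym)
  finally show "closedin (orbit_space X \<tau>) (?q ` C)"
    using closedin_subset [OF C] quotient_map_orbit_space [of X \<tau>]
    unfolding quotient_map_closedin by (metis image_mono)
qed

lemma normal_space_orbit_space:
  assumes "normal_space X" and "free_involution X \<tau>"
  shows "normal_space (orbit_space X \<tau>)"
  using normal_space_continuous_closed_map_image [OF assms(1)]
    closed_map_invol_orbit [OF assms(2)] quotient_map_orbit_space [of X \<tau>]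
  by (metis quotient_imp_continuous_map quotient_imp_surjective_map)

section \<open>From local sections to equivariant maps into spheres\<close>

text \<open>The closed sets \<open>C U\<close> serve as regions on which a Urysohn function that vanishes
  outside \<open>U\<close> equals one.  The set \<open>R\<close> stands for the part of the cover that has already been shrunk to open sets;
  without it the induction over \<open>\<V>\<close> would not go through.\<close>

lemma normal_space_shrinking:
  assumes Y: "normal_space Y" and "finite \<V>" and "\<And>U. U \<in> \<V> \<Longrightarrow> openin Y U"
    and "openin Y R" and "\<Union>\<V> \<union> R = topspace Y"
  shows "\<exists>C. (\<forall>U\<in>\<V>. closedin Y (C U) \<and> C U \<subseteq> U) \<and> (\<Union>U\<in>\<V>. C U) \<union> R = topspace Y"
  using assms(2-)
proof (induction \<V> arbitrary: R rule: finite_induct)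
  case empty
  then show ?case by simp
next
  case (insert U \<V>)
  let ?S = "topspace Y - (\<Union>\<V> \<union> R)"
  have "closedin Y ?S"
    using insert.prems by (intro closedin_diff) auto
  moreover have U: "openin Y U" "?S \<subseteq> U"
    using insert.prems by auto
  ultimately have "\<exists>W. openin Y W \<and> ?S \<subseteq> W \<and> Y closure_of W \<subseteq> U"
    using Y by (simp only: normal_space_alt)
  then obtain W where W: "openin Y W" "?S \<subseteq> W" "Y closure_of W \<subseteq> U"
    by blast
  have "openin Y (W \<union> R)"
    using W insert.prems by auto
  moreover have "\<Union>\<V> \<union> (W \<union> R) = topspace Y"
  proof
    show "\<Union>\<V> \<union> (W \<union> R) \<subseteq> topspace Y"
      using openin_subset [OF W(1)] insert.prems(3) by auto
    show "topspace Y \<subseteq> \<Union>\<V> \<union> (W \<union> R)"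
      using W(2) by blast
  qed
  ultimately obtain C where C: "\<forall>V\<in>\<V>. closedin Y (C V) \<and> C V \<subseteq> V"
      "(\<Union>V\<in>\<V>. C V) \<union> (W \<union> R) = topspace Y"
    using insert.IH [of "W \<union> R"] insert.prems by auto
  let ?C = "C(U := Y closure_of W)"
  have eq: "(\<Union>V\<in>\<V>. ?C V) = (\<Union>V\<in>\<V>. C V)"
    using insert.hyps by auto
  have "W \<subseteq> Y closure_of W" "Y closure_of W \<subseteq> topspace Y"
    using W by (simp_all add: closure_of_subset openin_subset closure_of_subset_topspace)
  then have "(\<Union>V\<in>insert U \<V>. ?C V) \<union> R = topspace Y"
    using C(2) unfolding UN_insert eq by auto
  moreover have "\<forall>V\<in>insert U \<V>. closedin Y (?C V) \<and> ?C V \<subseteq> V"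
    using C(1) W(3) by auto
  ultimately show ?case by blast
qed

text \<open>The zero set of \<open>g\<close> may meet the boundaries of \<open>V\<close> and \<open>W\<close>, but near a zero of \<open>g\<close> both
  \<open>g\<close> and \<open>- g\<close> are small, so the choice of sign does no harm.\<close>

lemma continuous_map_change_sign:
  fixes g :: "'a \<Rightarrow> real"
  assumes g: "continuous_map X euclideanreal g" and V: "openin X V" and W: "openin X W"
    and cover: "\<And>x. \<lbrakk>x \<in> topspace X; g x \<noteq> 0\<rbrakk> \<Longrightarrow> x \<in> V \<union> W" and "V \<inter> W = {}"
  shows "continuous_map X euclideanreal (\<lambda>x. if x \<in> V then g x else - g x)"
  unfolding continuous_map_def
proof (intro conjI allI impI)
  fix O' :: "real set" assume "openin euclidean O'"
  then have O': "open O'" "open (uminus ` O')"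
    using open_negations by auto
  let ?pre = "\<lambda>O'. {x \<in> topspace X. g x \<in> O'}"
  have pre: "openin X (?pre T)" if "open T" for T
    using g that by (simp add: openin_continuous_map_preimage)
  have "openin X (?pre O')" "openin X (?pre (uminus ` O'))" "openin X (?pre (O' \<inter> uminus ` O'))"
    using O' by (auto intro: pre simp del: Int_iff)
  \<comment> \<open>The third set contains the zeros of \<open>g\<close> in the preimage; there either sign lands in the target.\<close>
  then have "openin X (V \<inter> ?pre O' \<union> W \<inter> ?pre (uminus ` O') \<union> ?pre (O' \<inter> uminus ` O'))"
    using V W by (intro openin_Un openin_Int)
  also have "V \<inter> ?pre O' \<union> W \<inter> ?pre (uminus ` O') \<union> ?pre (O' \<inter> uminus ` O')
      = {x \<in> topspace X. (if x \<in> V then g x else - g x) \<in> O'}"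
  proof (intro set_eqI)
    fix x
    have m: "g x \<in> uminus ` O' \<longleftrightarrow> - g x \<in> O'"
      by force
    show "x \<in> V \<inter> ?pre O' \<union> W \<inter> ?pre (uminus ` O') \<union> ?pre (O' \<inter> uminus ` O')
      \<longleftrightarrow> x \<in> {x \<in> topspace X. (if x \<in> V then g x else - g x) \<in> O'}"
      using cover [of x] \<open>V \<inter> W = {}\<close> openin_subset [OF V] unfolding Un_iff Int_iff mem_Collect_eq m
      by (cases "g x = 0") auto
  qed
  finally show "openin X {x \<in> topspace X. (if x \<in> V then g x else - g x) \<in> O'}" .
qed auto

text \<open>Over \<open>U\<close> the section selects one of the two points of each orbit.  Giving \<open>g\<close> a plus sign at
  the selected point and a minus sign at the other makes it odd.  The selected points and the others
  form two open sets, since each is the complement in the preimage of \<open>U\<close> of the coincidence set of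
  two maps into a Hausdorff space.\<close>

lemma odd_function_from_section:
  assumes X: "Hausdorff_space X" and \<tau>: "free_involution X \<tau>"
    and U: "openin (orbit_space X \<tau>) U"
    and s: "continuous_map (subtopology (orbit_space X \<tau>) U) X s"
    and sec: "\<And>y. y \<in> U \<Longrightarrow> invol_orbit \<tau> (s y) = y"
    and g: "continuous_map (orbit_space X \<tau>) euclideanreal g"
    and g0: "\<And>y. \<lbrakk>y \<in> topspace (orbit_space X \<tau>); y \<notin> U\<rbrakk> \<Longrightarrow> g y = 0"
  obtains h where "continuous_map X euclideanreal h"
    "\<And>x. x \<in> topspace X \<Longrightarrow> h (\<tau> x) = - h x"
    "\<And>x. x \<in> topspace X \<Longrightarrow> \<bar>h x\<bar> = \<bar>g (invol_orbit \<tau> x)\<bar>"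
proof -
  let ?q = "invol_orbit \<tau>"
  have q: "continuous_map X (orbit_space X \<tau>) ?q"
    by (simp add: quotient_imp_continuous_map quotient_map_orbit_space)
  define Q where "Q = {x \<in> topspace X. ?q x \<in> U}"
  have Q: "openin X Q"
    unfolding Q_def using q U by (rule openin_continuous_map_preimage)
  let ?Q = "subtopology X Q"
  have topQ: "topspace ?Q = Q"
    by (auto simp: Q_def)
  have sq: "continuous_map ?Q X (\<lambda>x. s (?q x))"
  proof -
    have "continuous_map ?Q (subtopology (orbit_space X \<tau>) U) ?q"
      using q by (auto simp: continuous_map_in_subtopology continuous_map_from_subtopology Q_def)
    from continuous_map_compose [OF this s] show ?thesis
      by (simp add: o_def)
  qed
  have sq_cases: "s (?q x) = x \<or> s (?q x) = \<tau> x" if "x \<in> Q" for x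
  proof -
    have "x \<in> topspace X" "?q (s (?q x)) = ?q x"
      using that sec by (auto simp: Q_def)
    then show ?thesis
      using invol_orbit_eq_iff [OF \<tau>] by blast
  qed
  have open_agree: "openin X {x \<in> Q. s (?q x) \<noteq> u x}" if "continuous_map X X u" for u
  proof -
    have "continuous_map ?Q X u"
      using that by (rule continuous_map_from_subtopology)
    then have "openin ?Q (topspace ?Q - {x \<in> topspace ?Q. s (?q x) = u x})"
      by (intro openin_diff openin_topspace closedin_continuous_maps_eq [OF X sq])
    also have "topspace ?Q - {x \<in> topspace ?Q. s (?q x) = u x} = {x \<in> Q. s (?q x) \<noteq> u x}"
      unfolding topQ by blast
    finally show ?thesis
      using Q openin_trans_full by blast
  qed
  have \<tau>c: "continuous_map X X \<tau>" and \<tau>2: "\<And>x. x \<in> topspace X \<Longrightarrow> \<tau> (\<tau> x) = x \<and> \<tau> x \<noteq> x"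
    using \<tau> by (auto simp: free_involution_def)
  \<comment> \<open>These are the selected and the rejected points, written with \<open>\<noteq>\<close> so that openness comes from the Hausdorff property.\<close>
  define V where "V = {x \<in> Q. s (?q x) \<noteq> \<tau> x}"
  define W where "W = {x \<in> Q. s (?q x) \<noteq> x}"
  have VW: "openin X V" "openin X W"
    unfolding V_def W_def using open_agree [OF \<tau>c] open_agree [OF continuous_map_id]
    by simp_all
  have gq: "continuous_map X euclideanreal (\<lambda>x. g (?q x))"
    using continuous_map_compose [OF q g] by (simp add: o_def)
  let ?h = "\<lambda>x. if x \<in> V then g (?q x) else - g (?q x)"
  show thesis
  proof
    show "continuous_map X euclideanreal ?h"
    proof (rule continuous_map_change_sign [OF gq VW])
      show "x \<in> V \<union> W" if "x \<in> topspace X" "g (?q x) \<noteq> 0" for x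
      proof -
        have "?q x \<in> U"
          using g0 [of "?q x"] that by (auto simp: topspace_orbit_space)
        then show ?thesis
          using that \<tau>2 by (auto simp: V_def W_def Q_def)
      qed
      show "V \<inter> W = {}"
        using sq_cases by (auto simp: V_def W_def)
    qed
    show "?h (\<tau> x) = - ?h x" if x: "x \<in> topspace X" for x
    proof (cases "x \<in> Q")
      case True
      have "?q (\<tau> x) = ?q x"
        using \<tau>2 [OF x] by (auto simp: invol_orbit_def)
      moreover have "\<tau> x \<in> V \<longleftrightarrow> x \<notin> V"
        using True sq_cases [OF True] \<tau>2 [OF x] free_involution_in_topspace [OF \<tau> x]
          \<open>?q (\<tau> x) = ?q x\<close> by (auto simp: V_def Q_def)
      ultimately show ?thesis by simp
    next
      case False
      then have "g (?q x) = 0"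
        using x g0 by (auto simp: Q_def topspace_orbit_space)
      moreover have "?q (\<tau> x) = ?q x"
        using \<tau>2 [OF x] by (auto simp: invol_orbit_def)
      ultimately show ?thesis by simp
    qed
  qed auto
qed

lemma continuous_map_into_nsphere:
  assumes h: "\<And>i. i \<le> n \<Longrightarrow> continuous_map X euclideanreal (\<lambda>x. h x i)"
    and nz: "\<And>x. x \<in> topspace X \<Longrightarrow> \<exists>i\<le>n. h x i \<noteq> 0"
  shows "continuous_map X (nsphere n)
           (\<lambda>x i. if i < Suc n then h x i / sqrt (\<Sum>j\<le>n. h x j ^ 2) else 0)"
proof -
  have pos: "(\<Sum>j\<le>n. h x j ^ 2) > 0" if x: "x \<in> topspace X" for x
  proof -
    obtain i where "i \<le> n" "h x i \<noteq> 0"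
      using nz [OF x] by blast
    then show ?thesis
      by (intro sum_pos2 [of _ i]) auto
  qed
  have root: "continuous_map X euclideanreal (\<lambda>x. sqrt (\<Sum>j\<le>n. h x j ^ 2))"
    using h by (intro continuous_map_sqrt continuous_map_sum continuous_map_real_pow) auto
  have "continuous_map X (Euclidean_space (Suc n))
           (\<lambda>x i. if i < Suc n then h x i / sqrt (\<Sum>j\<le>n. h x j ^ 2) else 0)"
    unfolding continuous_map_componentwise_Euclidean_space
    using h root pos by (intro allI impI continuous_map_real_divide) (auto simp: less_Suc_eq_le, force)
  moreover have "(\<Sum>i\<le>n. (if i < Suc n then h x i / sqrt (\<Sum>j\<le>n. h x j ^ 2) else 0) ^ 2) = 1"
    if x: "x \<in> topspace X" for x
  proof -
    have "(\<Sum>i\<le>n. (if i < Suc n then h x i / sqrt (\<Sum>j\<le>n. h x j ^ 2) else 0) ^ 2)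
        = (\<Sum>i\<le>n. h x i ^ 2 / (\<Sum>j\<le>n. h x j ^ 2))"
      using pos [OF x] by (intro sum.cong) (auto simp: power_divide)
    also have "\<dots> = 1"
      using pos [OF x] by (simp flip: sum_divide_distrib)
    finally show ?thesis .
  qed
  ultimately show ?thesis
    by (auto simp: nsphere_def continuous_map_in_subtopology)
qed

text \<open>One coordinate for each member of the cover, namely a Urysohn function on the orbit space made
  odd by the section.  The closed shrinking ensures that some coordinate is nonzero at every point, so
  the vector can be normalised.\<close>

lemma equivariant_map_from_sections:
  assumes X: "Hausdorff_space X" and "normal_space X" and \<tau>: "free_involution X \<tau>"
    and "finite \<U>" and card: "card \<U> = Suc n"
    and op: "\<And>U. U \<in> \<U> \<Longrightarrow> openin (orbit_space X \<tau>) U"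
    and cov: "\<Union>\<U> = topspace (orbit_space X \<tau>)"
    and sec: "\<And>U. U \<in> \<U> \<Longrightarrow> \<exists>s. continuous_map (subtopology (orbit_space X \<tau>) U) X s \<and>
                              (\<forall>y\<in>U. invol_orbit \<tau> (s y) = y)"
  obtains f where "continuous_map X (nsphere n) f"
    "\<And>x. x \<in> topspace X \<Longrightarrow> f (\<tau> x) = (\<lambda>i. - f x i)"
proof -
  let ?Y = "orbit_space X \<tau>" and ?q = "invol_orbit \<tau>"
  have Y: "normal_space ?Y"
    using assms(2) \<tau> by (rule normal_space_orbit_space)
  obtain C where C: "\<And>U. U \<in> \<U> \<Longrightarrow> closedin ?Y (C U) \<and> C U \<subseteq> U" and Ccov: "(\<Union>U\<in>\<U>. C U) = topspace ?Y"
    using normal_space_shrinking [OF Y \<open>finite \<U>\<close> op, of "{}"] unfolding cov Un_empty_right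
    by (metis openin_empty)
  have "\<exists>h. continuous_map X euclideanreal h \<and> (\<forall>x \<in> topspace X. h (\<tau> x) = - h x) \<and>
            (\<forall>x \<in> topspace X. ?q x \<in> C U \<longrightarrow> h x \<noteq> 0)" if U: "U \<in> \<U>" for U
  proof -
    have "closedin ?Y (topspace ?Y - U)"
      using op U by blast
    moreover have "closedin ?Y (C U)" "disjnt (topspace ?Y - U) (C U)"
      using C [OF U] by (auto simp: disjnt_def)
    ultimately obtain g where g: "continuous_map ?Y euclideanreal g"
        "g ` (topspace ?Y - U) \<subseteq> {0}" "g ` C U \<subseteq> {1}"
      using Urysohn_lemma_alt [OF Y] by metis
    obtain s where s: "continuous_map (subtopology ?Y U) X s" "\<forall>y\<in>U. ?q (s y) = y"
      using sec U by blast
    obtain h where h: "continuous_map X euclideanreal h"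
        "\<And>x. x \<in> topspace X \<Longrightarrow> h (\<tau> x) = - h x"
        "\<And>x. x \<in> topspace X \<Longrightarrow> \<bar>h x\<bar> = \<bar>g (?q x)\<bar>"
      by (rule odd_function_from_section [OF X \<tau> op [OF U] s(1) _ g(1)]) (use s g in auto)
    have "h x \<noteq> 0" if "x \<in> topspace X" "?q x \<in> C U" for x
      using h(3) [OF that(1)] g(3) that(2) by auto
    with h show ?thesis by blast
  qed
  then obtain h where h: "\<And>U. U \<in> \<U> \<Longrightarrow> continuous_map X euclideanreal (h U)"
    and h\<tau>: "\<And>U x. \<lbrakk>U \<in> \<U>; x \<in> topspace X\<rbrakk> \<Longrightarrow> h U (\<tau> x) = - h U x"
    and hC: "\<And>U x. \<lbrakk>U \<in> \<U>; x \<in> topspace X; ?q x \<in> C U\<rbrakk> \<Longrightarrow> h U x \<noteq> 0"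
    by metis
  obtain e where e: "bij_betw e {0..<card \<U>} \<U>"
    using ex_bij_betw_nat_finite [OF \<open>finite \<U>\<close>] by blast
  have img: "e ` {..n} = \<U>"
    using e card by (simp add: bij_betw_def atLeast0LessThan lessThan_Suc_atMost)
  then have eU: "e i \<in> \<U>" if "i \<le> n" for i
    using that by blast
  let ?f = "\<lambda>x i. if i < Suc n then h (e i) x / sqrt (\<Sum>j\<le>n. h (e j) x ^ 2) else 0"
  show thesis
  proof
    show "continuous_map X (nsphere n) ?f"
    proof (rule continuous_map_into_nsphere)
      show "\<exists>i\<le>n. h (e i) x \<noteq> 0" if x: "x \<in> topspace X" for x
      proof -
        have "?q x \<in> (\<Union>U\<in>\<U>. C U)"
          using Ccov x by (simp add: topspace_orbit_space)
        then obtain U where U: "U \<in> \<U>" "?q x \<in> C U"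
          by blast
        then obtain i where "i \<le> n" "U = e i"
          using img by blast
        with hC [OF U(1) x U(2)] show ?thesis
          by blast
      qed
    qed (use h eU in auto)
    show "?f (\<tau> x) = (\<lambda>i. - ?f x i)" if "x \<in> topspace X" for x
      using that h\<tau> eU by (auto simp: fun_eq_iff less_Suc_eq_le)
  qed
qed

section \<open>From equivariant maps to local sections\<close>

text \<open>The sets \<open>P i\<close> where the \<open>i\<close>-th coordinate is positive are open and meet each orbit in at most
  one point, so the quotient map has a continuous inverse over their images.  These \<open>Suc n\<close> images
  cover the orbit space because a point of the sphere has a nonzero coordinate.\<close>

lemma secat_le_if_equivariant_map:
  assumes \<tau>: "free_involution X \<tau>" and f: "continuous_map X (nsphere n) f"
    and odd: "\<And>x. x \<in> topspace X \<Longrightarrow> f (\<tau> x) = (\<lambda>i. - f x i)"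
  shows "secat X (orbit_space X \<tau>) (invol_orbit \<tau>) \<le> enat (Suc n)"
proof -
  let ?Y = "orbit_space X \<tau>" and ?q = "invol_orbit \<tau>"
  have \<tau>c: "continuous_map X X \<tau>" and \<tau>2: "\<And>x. x \<in> topspace X \<Longrightarrow> \<tau> (\<tau> x) = x"
    using \<tau> by (auto simp: free_involution_def)
  define P where "P = (\<lambda>i. {x \<in> topspace X. f x i > 0})"
  have PX: "P i \<subseteq> topspace X" for i
    by (auto simp: P_def)
  have fi: "continuous_map X euclideanreal (\<lambda>x. f x i)" for i
    using continuous_map_compose [OF f continuous_map_nsphere_projection [of n i]]
    by (simp add: o_def)
  have P: "openin X (P i)" for i
    using openin_continuous_map_preimage [OF fi, of "{0<..}"] by (simp add: P_def)
  have open_q: "openin ?Y (?q ` T)" if "openin X T" for T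
  proof -
    have "openin X {x \<in> topspace X. \<tau> x \<in> T}"
      using \<tau>c that by (rule openin_continuous_map_preimage)
    then show ?thesis
      unfolding openin_orbit_space invol_orbit_preimage [OF \<tau> openin_subset [OF that]]
      using that openin_subset [OF that] by blast
  qed
  have inj: "inj_on ?q (P i)" for i
  proof (rule inj_onI)
    fix x z assume xz: "x \<in> P i" "z \<in> P i" "?q x = ?q z"
    then have "x = z \<or> x = \<tau> z"
      using invol_orbit_eq_iff [OF \<tau>] PX by blast
    moreover have "f (\<tau> z) i < 0"
      using xz(2) odd by (auto simp: P_def)
    ultimately show "x = z"
      using xz(1) by (auto simp: P_def)
  qed
  define s where "s = (\<lambda>i. inv_into (P i) ?q)"
  have sP: "s i y \<in> P i" "?q (s i y) = y" if "y \<in> ?q ` P i" for i y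
    using that by (auto simp: s_def inv_into_into f_inv_into_f)
  have "continuous_map (subtopology ?Y (?q ` P i)) X (s i)" for i
    unfolding continuous_map_def
  proof (intro conjI allI impI)
    show "s i \<in> topspace (subtopology ?Y (?q ` P i)) \<rightarrow> topspace X"
      using sP PX by fastforce
    fix T assume T: "openin X T"
    have "openin ?Y (?q ` (T \<inter> P i))"
      using open_q T P by blast
    moreover have "{y \<in> topspace (subtopology ?Y (?q ` P i)). s i y \<in> T} = ?q ` (T \<inter> P i)"
    proof -
      have "s i (?q x) = x" if "x \<in> P i" for x
        using inj that by (simp add: s_def)
      moreover have "?q ` P i \<subseteq> topspace ?Y"
        using PX by (auto simp: topspace_orbit_space)
      ultimately show ?thesis by auto
    qed
    ultimately show "openin (subtopology ?Y (?q ` P i)) {y \<in> topspace (subtopology ?Y (?q ` P i)). s i y \<in> T}"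
      by (metis P image_mono inf_le2 open_q openin_open_subtopology)
  qed
  then have sections: "\<exists>s. continuous_map (subtopology ?Y (?q ` P i)) X s \<and> (\<forall>y\<in>?q ` P i. ?q (s y) = y)" for i
    using sP by blast
  let ?\<U> = "(\<lambda>i. ?q ` P i) ` {..n}"
  have "\<Union>?\<U> = topspace ?Y"
  proof
    show "\<Union>?\<U> \<subseteq> topspace ?Y"
      using PX by (auto simp: topspace_orbit_space)
    show "topspace ?Y \<subseteq> \<Union>?\<U>"
    proof
      fix y assume "y \<in> topspace ?Y"
      then obtain x where x: "x \<in> topspace X" "y = ?q x"
        by (auto simp: topspace_orbit_space)
      have "f x \<in> topspace (nsphere n)"
        using f x by (auto simp: continuous_map_def)
      then have "(\<Sum>i\<le>n. f x i ^ 2) = 1"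
        by (simp add: nsphere)
      then obtain i where i: "i \<le> n" "f x i \<noteq> 0"
        by (metis (no_types, lifting) atMost_iff power_zero_numeral sum.neutral zero_neq_one)
      have "?q (\<tau> x) = y"
        using \<tau>2 [OF x(1)] x(2) by (auto simp: invol_orbit_def)
      moreover have "x \<in> P i \<or> \<tau> x \<in> P i"
        using i x odd free_involution_in_topspace [OF \<tau> x(1)] by (auto simp: P_def)
      ultimately show "y \<in> \<Union>?\<U>"
        using i x by blast
    qed
  qed
  then have "secat X ?Y ?q \<le> enat (card ?\<U>)"
    unfolding secat_def
  proof (intro Inf_lower CollectI exI [of _ ?\<U>] conjI refl)
    show "\<forall>U\<in>?\<U>. openin ?Y U"
      using open_q [OF P] by simp
    show "\<forall>U\<in>?\<U>. \<exists>s. continuous_map (subtopology ?Y U) X s \<and> (\<forall>y\<in>U. ?q (s y) = y)"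
    proof (rule ballI)
      fix U assume "U \<in> ?\<U>"
      then obtain i where "U = ?q ` P i"
        by blast
      then show "\<exists>s. continuous_map (subtopology ?Y U) X s \<and> (\<forall>y\<in>U. ?q (s y) = y)"
        using sections [of i] by (simp only:)
    qed
  qed simp_all
  also have "\<dots> \<le> enat (Suc n)"
    using card_image_le [of "{..n}" "\<lambda>i. ?q ` P i"] by simp
  finally show ?thesis .
qed

section \<open>The index and the sectional category\<close>

lemma Inf_enat_attained:
  assumes "Inf A = enat k"
  shows "enat k \<in> A"
proof -
  have "A \<noteq> {}"
    using assms by (auto simp: Inf_enat_def)
  then obtain a where "a \<in> A"
    by blast
  then have "(LEAST x. x \<in> A) \<in> A"
    by (rule LeastI)
  then show ?thesis
    using assms \<open>A \<noteq> {}\<close> by (simp add: Inf_enat_def)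
qed

text \<open>Equivariant maps to the \<open>n\<close>-sphere correspond to covers by \<open>Suc n\<close> open sets with sections.
  A finite sectional category is attained by some cover.\<close>

theorem involution_index_eq_secat_minus_1:
  assumes X: "Hausdorff_space X" and "normal_space X" and \<tau>: "free_involution X \<tau>"
    and secat: "secat X (orbit_space X \<tau>) (invol_orbit \<tau>) = enat (Suc n)"
  shows "involution_index X \<tau> = enat n"
proof (rule antisym)
  let ?Y = "orbit_space X \<tau>" and ?q = "invol_orbit \<tau>"
  let ?covers = "\<lambda>\<U>. finite \<U> \<and> (\<forall>U\<in>\<U>. openin ?Y U) \<and> \<Union>\<U> = topspace ?Y \<and>
            (\<forall>U\<in>\<U>. \<exists>s. continuous_map (subtopology ?Y U) X s \<and> (\<forall>y\<in>U. ?q (s y) = y))"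
  have "enat (Suc n) \<in> {enat (card \<U>) | \<U>. ?covers \<U>}"
    using secat unfolding secat_def by (rule Inf_enat_attained)
  then obtain \<U> where \<U>: "enat (Suc n) = enat (card \<U>) \<and> ?covers \<U>"
    unfolding mem_Collect_eq by (rule exE)
  then have card: "card \<U> = Suc n"
    by simp
  obtain f where "continuous_map X (nsphere n) f"
      "\<And>x. x \<in> topspace X \<Longrightarrow> f (\<tau> x) = (\<lambda>i. - f x i)"
    by (rule equivariant_map_from_sections [OF X assms(2) \<tau> _ card]) (use \<U> in blast)+
  then show "involution_index X \<tau> \<le> enat n"
    unfolding involution_index_def by (intro Inf_lower CollectI exI [of _ n] exI [of _ f] conjI refl ballI)
  show "enat n \<le> involution_index X \<tau>"
    unfolding involution_index_def
  proof (rule Inf_greatest, clarify)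
    fix k f
    assume "continuous_map X (nsphere k) f" "\<forall>x\<in>topspace X. f (\<tau> x) = (\<lambda>i. - f x i)"
    then have "enat (Suc n) \<le> enat (Suc k)"
      using secat_le_if_equivariant_map [OF \<tau>] secat by metis
    then show "enat n \<le> enat k"
      by simp
  qed
qed

theorem corollary3p31:
  fixes X :: "'a topology" and E :: "nat \<Rightarrow> 'a set set" and m :: nat and \<tau> :: "'a \<Rightarrow> 'a"
  assumes "cw_complex X E" and "cw_dimension E m" and "connected_space X"
    and "free_involution X \<tau>" and "cellular_map E E \<tau>"
    and "secat X (orbit_space X \<tau>) (invol_orbit \<tau>) = enat (m + 1)"
  shows "involution_index X \<tau> = enat m"
proof (rule involution_index_eq_secat_minus_1)
  show "Hausdorff_space X"
    using assms(1) by (rule cw_Hausdorff)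
  show "normal_space X"
    using assms(1) by (rule cw_complex_imp_normal_space)
qed (use assms in simp_all)

end
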